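(* Let $X$ be a well-formed C++ execution with transactions that is C++-consistent (satisfies HbCom, RMWIsol, NoThinAir and SeqCst), whose atomic transactions contain no atomic operations ($\mathrm{domain}(\mathit{stxn}_{\rm at})\cap\mathit{Ato}=\emptyset$). If $X$ has - no relaxed transactions (i.e. $\mathit{stxn}=\mathit{stxn}_{\rm at}$), - no non-SC atomics (i.e. $\mathit{Ato}=\mathit{SC}$), and - no data races (i.e. NoRace holds), then $X$ is consistent under transactional sequential consistency (TSC); that is, both $\mathit{po}\cup\mathit{com}$ and $\mathsf{stronglift}(\mathit{po}\cup\mathit{com},\mathit{stxn})$ are acyclic.
   Context: **Notation.** For binary relations on a set of events $E$: $r^{-1}$, $r^?$, $r^+$, $r^*$ are inverse, reflexive closure, transitive closure, reflexive-transitive closure; $\neg$ is complement; $r_1;r_2$ is relational composition (left to right); $[s]=\{(x,x)\mid x\in s\}$; a relation $r$ is acyclic iff $r^+$ is irreflexive; $\mathit{id}$ is the identity. For an execution with program order $\mathit{po}$ and same-location relation $\mathit{sloc}$: $r_{\rm e}=r\setminus(\mathit{po}\cup\mathit{po}^{-1})^*$ (inter-thread part), $r_{\rm loc}=r\cap\mathit{sloc}$, $r_{\neq\rm loc}=r\setminus\mathit{sloc}$. **Executions.** An execution is a finite set $E$ of events, partitioned into reads $R$, writes $W$, fences $F$, with relations satisfying: $\mathit{po}$ is, for each thread, a strict total order on that thread's events (and relates only events of the same thread); $\mathit{sloc}$ is an equivalence relation on $R\cup W$ (same location); $\mathit{rmw}\subseteq\mathit{po}_{\rm loc}$ links the read of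 a read-modify-write operation to its write; $\mathit{rf}$ goes from writes to reads of the same location, each read having at most one incoming $\mathit{rf}$ edge (a read with none reads the initial value); $\mathit{co}$ relates writes to the same location and is, for each location, a strict total order on the writes to it; $\mathit{stxn}$ (events in the same successful transaction) is a partial equivalence relation (symmetric, transitive) each of whose classes is a contiguous subset of $\mathit{po}$ (of one thread). Derived: $\mathit{fr}=([R];\mathit{sloc};[W])\setminus(\mathit{rf}^{-1};(\mathit{co}^{-1})^* )$ and $\mathit{com}=\mathit{rf}\cup\mathit{co}\cup\mathit{fr}$. Also $$\mathsf{weaklift}(r,t)=t;(r\setminus t);t,\qquad \mathsf{stronglift}(r,t)=t^?;(r\setminus t);t^?.$$ **C++ executions** have in addition sets of events $\mathit{Ato}$ (events of atomic operations) and $\mathit{Acq},\mathit{Rel},\mathit{SC}\subseteq\mathit{Ato}$ (acquire, release, SC modes), with $R\cap\mathit{SC}\subseteq\mathit{Acq}$, $W\cap\mathit{SC}\subseteq\mathit{Rel}$, $F\cap\mathit{SC}\subseteq\mathit{Acq}\cap\mathit{Rel}$, and both ends of $\mathit{rmw}$ edges in $\mathit{Ato}$. The relation $\mathit{stxn}_{\rm at}$ is a partial equivalence relation identifying a subset of the transactions as atomic (its classes are some of the $\mathit{stxn}$ classes); the others are relaxed transactions. **C++ relations.** - $\mathit{sw}=[\mathit{Rel}];([F];\mathit{po})^?;[W];\mathit{po}_{\rm loc}^*;[W\cap\mathit{Ato}];(\mathit{rf};\mathit{rmw})^*;\mathit{rf};[R\cap\mathit{Ato}];(\mathit{po};[F])^?;[\mathit{Acq}]$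 - $\mathit{ecom}=\mathit{com}\cup(\mathit{co};\mathit{rf})$, $\quad\mathit{tsw}=\mathsf{weaklift}(\mathit{ecom},\mathit{stxn})$, $\quad\mathit{hb}=(\mathit{sw}\cup\mathit{tsw}\cup\mathit{po})^+$ - $\mathit{scb}=\mathit{po}\cup(\mathit{po}_{\neq\rm loc};\mathit{hb};\mathit{po}_{\neq\rm loc})\cup\mathit{hb}_{\rm loc}\cup\mathit{co}\cup\mathit{fr}$ - $\mathit{psc}=\big(([\mathit{SC}]\cup[F\cap\mathit{SC}];\mathit{hb}^?);\mathit{scb};([\mathit{SC}]\cup\mathit{hb}^?;[F\cap\mathit{SC}])\big)\cup\big([F\cap\mathit{SC}];(\mathit{hb}\cup\mathit{hb};\mathit{com}^+;\mathit{hb});[F\cap\mathit{SC}]\big)$ - $\mathit{cnf}=((W\times W)\cup(R\times W)\cup(W\times R))\cap\mathit{sloc}\setminus\mathit{id}$ **Consistency axioms.** HbCom: $\mathit{hb};\mathit{com}^*$ is irreflexive. RMWIsol: $\mathit{rmw}\cap(\mathit{fr}_{\rm e};\mathit{co}_{\rm e})=\emptyset$. NoThinAir: $\mathit{po}\cup\mathit{rf}$ is acyclic. SeqCst: $\mathit{psc}$ is acyclic. **Race freedom.** NoRace: $\mathit{cnf}\setminus\mathit{Ato}^2\setminus(\mathit{hb}\cup\mathit{hb}^{-1})=\emptyset$. *)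

theory Defs
  imports Main
begin

text \<open>
  Relational composition \<open>r\<^sub>1; r\<^sub>2\<close> (left to right) is \<^term>\<open>r\<^sub>1 O r\<^sub>2\<close>, and the relation
  \<open>[s]\<close> is \<^term>\<open>Id_on s\<close>.
\<close>

definition weaklift :: "'e rel \<Rightarrow> 'e rel \<Rightarrow> 'e rel" where
  "weaklift r t = t O (r - t) O t"

definition stronglift :: "'e rel \<Rightarrow> 'e rel \<Rightarrow> 'e rel" where
  "stronglift r t = t\<^sup>= O (r - t) O t\<^sup>="

definition per_classes :: "'e rel \<Rightarrow> 'e set set" where
  "per_classes r = Field r // r"


section \<open>Executions\<close>

record ('e, 't) execution =
  evts :: "'e set"
  reads :: "'e set"
  writes :: "'e set"
  fences :: "'e set"
  tid :: "'e \<Rightarrow> 't"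
  po :: "'e rel"
  sloc :: "'e rel"
  rmw :: "'e rel"
  rf :: "'e rel"
  co :: "'e rel"
  stxn :: "'e rel"

definition thread_evts :: "('e, 't, 'z) execution_scheme \<Rightarrow> 't \<Rightarrow> 'e set" where
  "thread_evts X t = {e \<in> evts X. tid X e = t}"

definition ext :: "('e, 't, 'z) execution_scheme \<Rightarrow> 'e rel \<Rightarrow> 'e rel" where
  "ext X r = r - (po X \<union> (po X)\<inverse>)\<^sup>*"

definition loc :: "('e, 't, 'z) execution_scheme \<Rightarrow> 'e rel \<Rightarrow> 'e rel" where
  "loc X r = r \<inter> sloc X"

definition nloc :: "('e, 't, 'z) execution_scheme \<Rightarrow> 'e rel \<Rightarrow> 'e rel" where
  "nloc X r = r - sloc X"

definition wf_execution :: "('e, 't, 'z) execution_scheme \<Rightarrow> bool" where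
  "wf_execution X \<longleftrightarrow>
     finite (evts X) \<and>
     evts X = reads X \<union> writes X \<union> fences X \<and>
     reads X \<inter> writes X = {} \<and> reads X \<inter> fences X = {} \<and> writes X \<inter> fences X = {} \<and>
     po X \<subseteq> {(x, y). x \<in> evts X \<and> y \<in> evts X \<and> tid X x = tid X y} \<and>
     (\<forall>t. strict_linear_order_on (thread_evts X t)
            (po X \<inter> (thread_evts X t \<times> thread_evts X t))) \<and>
     equiv (reads X \<union> writes X) (sloc X) \<and>
     rmw X \<subseteq> (reads X \<times> writes X) \<inter> loc X (po X) \<and>
     rf X \<subseteq> (writes X \<times> reads X) \<inter> sloc X \<and>
     single_valued ((rf X)\<inverse>) \<and>
     co X \<subseteq> (writes X \<times> writes X) \<inter> sloc X \<and>
     (\<forall>C \<in> (reads X \<union> writes X) // sloc X.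
        strict_linear_order_on (C \<inter> writes X)
          (co X \<inter> ((C \<inter> writes X) \<times> (C \<inter> writes X)))) \<and>
     stxn X \<subseteq> evts X \<times> evts X \<and> sym (stxn X) \<and> trans (stxn X) \<and>
     (\<forall>C \<in> per_classes (stxn X).
        (\<exists>t. C \<subseteq> thread_evts X t) \<and>
        (\<forall>x \<in> C. \<forall>z \<in> C. \<forall>y. (x, y) \<in> po X \<and> (y, z) \<in> po X \<longrightarrow> y \<in> C))"

text \<open>
  A read without an incoming \<open>rf\<close> edge reads the initial value; it is therefore
  \<open>fr\<close>-before every write to its location.
\<close>

definition fr :: "('e, 't, 'z) execution_scheme \<Rightarrow> 'e rel" where
  "fr X = (Id_on (reads X) O sloc X O Id_on (writes X)) - ((rf X)\<inverse> O ((co X)\<inverse>)\<^sup>*)"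

definition com :: "('e, 't, 'z) execution_scheme \<Rightarrow> 'e rel" where
  "com X = rf X \<union> co X \<union> fr X"

definition tsc_consistent :: "('e, 't, 'z) execution_scheme \<Rightarrow> bool" where
  "tsc_consistent X \<longleftrightarrow>
     acyclic (po X \<union> com X) \<and> acyclic (stronglift (po X \<union> com X) (stxn X))"


section \<open>C++ executions\<close>

record ('e, 't) cpp_execution = "('e, 't) execution" +
  Ato :: "'e set"
  Acq :: "'e set"
  Rel :: "'e set"
  SC :: "'e set"
  stxn_at :: "'e rel"

definition wf_cpp_execution :: "('e, 't, 'z) cpp_execution_scheme \<Rightarrow> bool" where
  "wf_cpp_execution X \<longleftrightarrow>
     wf_execution X \<and>
     Ato X \<subseteq> evts X \<and>
     Acq X \<subseteq> Ato X \<and> Rel X \<subseteq> Ato X \<and> SC X \<subseteq> Ato X \<and>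
     reads X \<inter> SC X \<subseteq> Acq X \<and>
     writes X \<inter> SC X \<subseteq> Rel X \<and>
     fences X \<inter> SC X \<subseteq> Acq X \<inter> Rel X \<and>
     rmw X \<subseteq> Ato X \<times> Ato X \<and>
     sym (stxn_at X) \<and> trans (stxn_at X) \<and>
     per_classes (stxn_at X) \<subseteq> per_classes (stxn X)"

definition sw :: "('e, 't, 'z) cpp_execution_scheme \<Rightarrow> 'e rel" where
  "sw X =
     Id_on (Rel X) O (Id_on (fences X) O po X)\<^sup>= O Id_on (writes X) O (loc X (po X))\<^sup>* O
     Id_on (writes X \<inter> Ato X) O (rf X O rmw X)\<^sup>* O rf X O Id_on (reads X \<inter> Ato X) O
     (po X O Id_on (fences X))\<^sup>= O Id_on (Acq X)"

definition ecom :: "('e, 't, 'z) execution_scheme \<Rightarrow> 'e rel" where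
  "ecom X = com X \<union> (co X O rf X)"

definition tsw :: "('e, 't, 'z) execution_scheme \<Rightarrow> 'e rel" where
  "tsw X = weaklift (ecom X) (stxn X)"

definition hb :: "('e, 't, 'z) cpp_execution_scheme \<Rightarrow> 'e rel" where
  "hb X = (sw X \<union> tsw X \<union> po X)\<^sup>+"

definition scb :: "('e, 't, 'z) cpp_execution_scheme \<Rightarrow> 'e rel" where
  "scb X =
     po X \<union> (nloc X (po X) O hb X O nloc X (po X)) \<union> loc X (hb X) \<union> co X \<union> fr X"

definition psc :: "('e, 't, 'z) cpp_execution_scheme \<Rightarrow> 'e rel" where
  "psc X =
     ((Id_on (SC X) \<union> (Id_on (fences X \<inter> SC X) O (hb X)\<^sup>=)) O scb X O
      (Id_on (SC X) \<union> ((hb X)\<^sup>= O Id_on (fences X \<inter> SC X)))) \<union>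
     (Id_on (fences X \<inter> SC X) O (hb X \<union> (hb X O (com X)\<^sup>+ O hb X)) O
      Id_on (fences X \<inter> SC X))"

definition cnf :: "('e, 't, 'z) execution_scheme \<Rightarrow> 'e rel" where
  "cnf X =
     (((writes X \<times> writes X) \<union> (reads X \<times> writes X) \<union> (writes X \<times> reads X)) \<inter> sloc X) - Id"

definition HbCom :: "('e, 't, 'z) cpp_execution_scheme \<Rightarrow> bool" where
  "HbCom X \<longleftrightarrow> irrefl (hb X O (com X)\<^sup>*)"

definition RMWIsol :: "('e, 't, 'z) execution_scheme \<Rightarrow> bool" where
  "RMWIsol X \<longleftrightarrow> rmw X \<inter> (ext X (fr X) O ext X (co X)) = {}"

definition NoThinAir :: "('e, 't, 'z) execution_scheme \<Rightarrow> bool" where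
  "NoThinAir X \<longleftrightarrow> acyclic (po X \<union> rf X)"

definition SeqCst :: "('e, 't, 'z) cpp_execution_scheme \<Rightarrow> bool" where
  "SeqCst X \<longleftrightarrow> acyclic (psc X)"

definition cpp_consistent :: "('e, 't, 'z) cpp_execution_scheme \<Rightarrow> bool" where
  "cpp_consistent X \<longleftrightarrow> HbCom X \<and> RMWIsol X \<and> NoThinAir X \<and> SeqCst X"

definition NoRace :: "('e, 't, 'z) cpp_execution_scheme \<Rightarrow> bool" where
  "NoRace X \<longleftrightarrow> (cnf X - (Ato X \<times> Ato X)) - (hb X \<union> (hb X)\<inverse>) = {}"

end

theory Submission
  imports Defs
begin

text \<open>
  Call \<open>N\<close> the part of \<open>co \<union> fr\<close> between SC events.  Race freedom gives \<open>com \<subseteq> hb \<union> N\<close>, and as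
  transactions contain no atomics, \<open>hb\<close> edges that leave or enter a transaction lift to all its
  events; hence \<open>po \<union> com\<close> and its strong lifting are both contained in \<open>hb \<union> N\<close>.  To see that
  \<open>hb \<union> N\<close> is acyclic, take a cycle with the fewest \<open>N\<close> edges.  An \<open>hb\<close> segment between two
  \<open>N\<close> edges is either covered by \<open>psc\<close>, or it passes through a non-atomic access to the
  location of one of its end points.  In the latter case race freedom orders that access by \<open>hb\<close>
  with respect to the far end of the neighbouring \<open>N\<close> edge, so this edge can be bypassed,
  contradicting minimality.  Hence the cycle is a \<open>psc\<close> cycle.
\<close>

section \<open>Cycles in a union of two relations\<close>

lemma trancl_Un_subset:
  "(H \<union> N)\<^sup>+ \<subseteq> H\<^sup>+ \<union> H\<^sup>* O (N O H\<^sup>*)\<^sup>+"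
proof (rule subrelI)
  fix x y assume "(x, y) \<in> (H \<union> N)\<^sup>+"
  then show "(x, y) \<in> H\<^sup>+ \<union> H\<^sup>* O (N O H\<^sup>*)\<^sup>+"
  proof (induction rule: trancl_induct)
    case (base y)
    then show ?case by blast
  next
    case (step y z)
    have absorb: "(u, z) \<in> (N O H\<^sup>*)\<^sup>+" if "(u, y) \<in> (N O H\<^sup>*)\<^sup>+" "(y, z) \<in> H" for u
    proof -
      from that(1) obtain p where "(u, p) \<in> (N O H\<^sup>*)\<^sup>*" "(p, y) \<in> N O H\<^sup>*"
        by (meson tranclD2)
      moreover from this(2) that(2) have "(p, z) \<in> N O H\<^sup>*"
        by (blast intro: rtrancl_into_rtrancl)
      ultimately show ?thesis by (meson rtrancl_into_trancl1)
    qed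
    show ?case
    proof (cases "(y, z) \<in> H")
      case True
      with step.IH absorb show ?thesis by (blast intro: trancl_into_trancl)
    next
      case False
      with step.hyps have "(y, z) \<in> N O H\<^sup>*" by auto
      with step.IH show ?thesis
        by (blast intro: trancl_into_trancl dest: trancl_into_rtrancl)
    qed
  qed
qed

text \<open>The second alternative of \<open>bypass\<close> skips the \<open>N\<close> edge before
  the \<open>H\<close> segment, the third skips the one after it. Either would shorten a cycle with
  the fewest \<open>N\<close> edges, so on such a cycle only the first remains.\<close>

lemma acyclic_Un_bypass:
  assumes H: "trans H" "irrefl H"
    and S: "N \<subseteq> S" "acyclic S"
    and bypass: "\<And>d a b e. (d, a) \<in> N \<Longrightarrow> (a, b) \<in> H \<Longrightarrow> (b, e) \<in> N \<Longrightarrow>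
      (a, b) \<in> S\<^sup>+ \<or> (d, b) \<in> H \<or> (a, e) \<in> H"
  shows "acyclic (H \<union> N)"
proof (rule ccontr)
  define K where "K = N O H\<^sup>*"
  have H_rtrancl: "H\<^sup>* = H\<^sup>="
    using H(1) by (metis rtrancl_trancl_reflcl trancl_id)
  assume "\<not> acyclic (H \<union> N)"
  then obtain x where "(x, x) \<in> (H \<union> N)\<^sup>+" by (auto simp: acyclic_def)
  then have "(x, x) \<in> H\<^sup>+ \<union> H\<^sup>* O K\<^sup>+" unfolding K_def using trancl_Un_subset by blast
  moreover have "(x, x) \<notin> H\<^sup>+" using H by (simp add: irrefl_def)
  ultimately obtain y where y: "(x, y) \<in> H\<^sup>*" "(y, x) \<in> K\<^sup>+" by blast
  from y(2) obtain u where "(y, u) \<in> K\<^sup>*" "(u, x) \<in> K" by (meson tranclD2)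
  \<comment> \<open>The leading \<open>H\<close> segment is moved to the end of the cycle, where the
    last \<open>K\<close> step absorbs it; the cycle then starts with an \<open>N\<close>
    edge.\<close>
  with y(1) have "(u, y) \<in> K" unfolding K_def by (auto intro: rtrancl_trans)
  with \<open>(y, u) \<in> K\<^sup>*\<close> have "(y, y) \<in> K\<^sup>+" by (rule rtrancl_into_trancl1)
  then have ex: "\<exists>n. n > 0 \<and> (\<exists>y. (y, y) \<in> K ^^ n)" by (auto simp: trancl_power)
  define n where "n = (LEAST n. n > 0 \<and> (\<exists>y. (y, y) \<in> K ^^ n))"
  obtain y where n: "n > 0" and yn: "(y, y) \<in> K ^^ n"
    using LeastI_ex[OF ex] unfolding n_def by blast
  have minimal: "(z, z) \<notin> K ^^ m" if "m < n" "m > 0" for m z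
    using not_less_Least[OF that(1)[unfolded n_def]] that(2) by blast
  \<comment> \<open>The assumption \<open>closing\<close> says that the step lies on a cycle of the
    minimal length \<open>n\<close>.\<close>
  have edge: "(w, z) \<in> S\<^sup>+" if wz: "(w, z) \<in> K" and closing: "(z, w) \<in> K ^^ (n - 1)" for w z
  proof -
    from wz obtain a where a: "(w, a) \<in> N" "a = z \<or> (a, z) \<in> H"
      unfolding K_def H_rtrancl by auto
    have wa: "(w, a) \<in> S\<^sup>+" using a(1) S(1) by auto
    consider "a = z" | "(a, z) \<in> S\<^sup>+" | "(a, z) \<in> H" "(a, z) \<notin> S\<^sup>+" using a(2) by blast
    then show ?thesis
    proof cases
      case 1
      then show ?thesis using wa by simp
    next
      case 2
      then show ?thesis using wa by simp
    next
      case 3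
      show ?thesis
      proof (cases "n - 1")
        case 0
        \<comment> \<open>With \<open>n = 1\<close> the \<open>N\<close> edges before and after the
          segment coincide, and both shortcuts become loops in \<open>H\<close>.\<close>
        with closing have "z = w" by simp
        with bypass[OF a(1) 3(1)] a(1) 3(2) H(2) show ?thesis by (auto simp: irrefl_def)
      next
        case (Suc m)
        then have m: "Suc m < n" by simp
        from closing Suc obtain v where v: "(z, v) \<in> K" "(v, w) \<in> K ^^ m"
          by (metis relpow_Suc_D2)
        from closing Suc obtain u where u: "(z, u) \<in> K ^^ m" "(u, w) \<in> K"
          by (metis relpow_Suc_E)
        from v(1) obtain e where e: "(z, e) \<in> N" "(e, v) \<in> H\<^sup>*" unfolding K_def by auto
        from bypass[OF a(1) 3(1) e(1)] 3(2)
        consider "(w, z) \<in> H" | "(a, e) \<in> H" by blast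
        \<comment> \<open>The first shortcut is absorbed by the preceding step from
          \<open>u\<close>; the second merges the steps to \<open>z\<close> and to \<open>v\<close>
          into one. Both leave a cycle of length \<open>n - 1\<close>.\<close>
        then have "\<exists>p. (p, p) \<in> K ^^ Suc m"
        proof cases
          case 1
          with u(2) have "(u, z) \<in> K" unfolding K_def by (auto intro: rtrancl_into_rtrancl)
          with u(1) show ?thesis by (metis relpow_Suc_I)
        next
          case 2
          with a(1) e(2) have "(w, v) \<in> K" unfolding K_def
            by (auto intro: converse_rtrancl_into_rtrancl)
          with v(2) show ?thesis by (metis relpow_Suc_I2)
        qed
        with minimal[OF m] show ?thesis by blast
      qed
    qed
  qed
  \<comment> \<open>The induction along the cycle carries the way back to \<open>y\<close>, so that
    at each step the rest of the cycle is available as \<open>closing\<close>.\<close>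
  have "k = 0 \<and> z = y \<or> (y, z) \<in> S\<^sup>+"
    if "k \<le> n" "(y, z) \<in> K ^^ k" "(z, y) \<in> K ^^ (n - k)" for k z
    using that
  proof (induction k arbitrary: z)
    case 0
    then show ?case by simp
  next
    case (Suc k)
    from Suc.prems(2) obtain w where w: "(y, w) \<in> K ^^ k" "(w, z) \<in> K" by auto
    have "(w, y) \<in> K ^^ (n - k)"
      using relpow_Suc_I2[OF w(2) Suc.prems(3)] Suc.prems(1)
      by (simp add: Suc_diff_Suc Suc_le_eq)
    with Suc.IH w(1) Suc.prems(1) have "w = y \<or> (y, w) \<in> S\<^sup>+" by auto
    moreover have "(z, w) \<in> K ^^ (n - Suc k + k)"
      using Suc.prems(3) w(1) unfolding relpow_add by blast
    with Suc.prems(1) have "(z, w) \<in> K ^^ (n - 1)" by simp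
    ultimately show ?case using edge[OF w(2)] by auto
  qed
  from this[of n y] yn n have "(y, y) \<in> S\<^sup>+" by simp
  with S(2) show False by (simp add: acyclic_def)
qed


section \<open>Well-formed executions: transactions, communication, synchronisation\<close>

locale wf_cpp =
  fixes X :: "('e, 't, 'z) cpp_execution_scheme"
  assumes wf_cpp: "wf_cpp_execution X"
begin

lemma wf: "wf_execution X"
  using wf_cpp by (simp add: wf_cpp_execution_def)

lemma po_thread: "(x, y) \<in> po X \<Longrightarrow> x \<in> evts X \<and> y \<in> evts X \<and> tid X x = tid X y"
  using wf by (auto simp: wf_execution_def)

lemma thread_order:
  "strict_linear_order_on (thread_evts X t) (po X \<inter> (thread_evts X t \<times> thread_evts X t))"
  using wf by (auto simp: wf_execution_def)

lemma po_trans: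
  assumes "(x, y) \<in> po X" "(y, z) \<in> po X"
  shows "(x, z) \<in> po X"
proof -
  let ?T = "thread_evts X (tid X x)"
  have "trans (po X \<inter> (?T \<times> ?T))"
    using thread_order by (simp add: strict_linear_order_on_def)
  moreover have "(x, y) \<in> po X \<inter> (?T \<times> ?T)" "(y, z) \<in> po X \<inter> (?T \<times> ?T)"
    using assms po_thread by (auto simp: thread_evts_def)
  ultimately show ?thesis by (blast dest: transD)
qed

lemma po_total:
  assumes "x \<in> evts X" "y \<in> evts X" "tid X x = tid X y" "x \<noteq> y"
  shows "(x, y) \<in> po X \<or> (y, x) \<in> po X"
proof -
  let ?T = "thread_evts X (tid X x)"
  have "total_on ?T (po X \<inter> (?T \<times> ?T))"
    using thread_order by (simp add: strict_linear_order_on_def)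
  moreover have "x \<in> ?T" "y \<in> ?T" using assms by (auto simp: thread_evts_def)
  ultimately show ?thesis using assms(4) by (auto simp: total_on_def)
qed

lemma stxn_sym: "(x, y) \<in> stxn X \<Longrightarrow> (y, x) \<in> stxn X"
  using wf by (auto simp: wf_execution_def dest: symD)

lemma stxn_trans: "(x, y) \<in> stxn X \<Longrightarrow> (y, z) \<in> stxn X \<Longrightarrow> (x, z) \<in> stxn X"
  using wf by (auto simp: wf_execution_def dest: transD)

lemma stxn_class:
  assumes "(x, y) \<in> stxn X"
  shows "x \<in> evts X" "y \<in> evts X" "tid X x = tid X y"
    and "(x, w) \<in> po X \<Longrightarrow> (w, y) \<in> po X \<Longrightarrow> (x, w) \<in> stxn X"
proof -
  let ?C = "stxn X `` {x}"
  have "?C \<in> per_classes (stxn X)"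
    using assms by (auto simp: per_classes_def Field_def intro: quotientI)
  then have C: "\<exists>t. ?C \<subseteq> thread_evts X t"
    "\<forall>u \<in> ?C. \<forall>z \<in> ?C. \<forall>y. (u, y) \<in> po X \<and> (y, z) \<in> po X \<longrightarrow> y \<in> ?C"
    using wf unfolding wf_execution_def by blast+
  have xy: "x \<in> ?C" "y \<in> ?C" using assms by (auto intro: stxn_sym stxn_trans)
  show "x \<in> evts X" "y \<in> evts X" "tid X x = tid X y"
    using C(1) xy by (auto simp: thread_evts_def)
  show "(x, w) \<in> po X \<Longrightarrow> (w, y) \<in> po X \<Longrightarrow> (x, w) \<in> stxn X"
    using C(2) xy by blast
qed

text \<open>If \<open>z\<close> came before \<open>w\<close>, then \<open>w\<close> would lie
  between two events of one transaction and belong to it by contiguity. The next lemma is the mirror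
  image.\<close>

lemma po_stxn:
  assumes "(w, y) \<in> po X" "(y, z) \<in> stxn X" "(w, y) \<notin> stxn X"
  shows "(w, z) \<in> po X"
proof -
  note zy = stxn_sym[OF assms(2)]
  have "w \<noteq> z" using assms(3) zy by auto
  moreover have "(z, w) \<notin> po X"
    using stxn_class(4)[OF zy _ assms(1)] assms(3) zy by (meson stxn_sym stxn_trans)
  ultimately show ?thesis
    using po_total[of w z] po_thread[OF assms(1)] stxn_class(1-3)[OF assms(2)] by auto
qed

lemma stxn_po:
  assumes "(x, y) \<in> stxn X" "(y, w) \<in> po X" "(y, w) \<notin> stxn X"
  shows "(x, w) \<in> po X"
proof -
  note yx = stxn_sym[OF assms(1)]
  have "w \<noteq> x" using assms(3) yx by auto
  moreover have "(w, x) \<notin> po X"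
    using stxn_class(4)[OF yx assms(2)] assms(3) by blast
  ultimately show ?thesis
    using po_total[of w x] po_thread[OF assms(2)] stxn_class(1-3)[OF assms(1)] by auto
qed

lemma tsw_stxn: "(x, y) \<in> tsw X \<Longrightarrow> (y, z) \<in> stxn X \<Longrightarrow> (x, z) \<in> tsw X"
  by (auto simp: tsw_def weaklift_def intro: stxn_trans)

lemma stxn_tsw: "(x, y) \<in> stxn X \<Longrightarrow> (y, z) \<in> tsw X \<Longrightarrow> (x, z) \<in> tsw X"
  by (auto simp: tsw_def weaklift_def intro: stxn_trans)

lemma hb_trans: "(x, y) \<in> hb X \<Longrightarrow> (y, z) \<in> hb X \<Longrightarrow> (x, z) \<in> hb X"
  by (auto simp: hb_def)

lemma po_hb: "(x, y) \<in> po X \<Longrightarrow> (x, y) \<in> hb X"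
  by (auto simp: hb_def)

lemma tsw_hb: "(x, y) \<in> tsw X \<Longrightarrow> (x, y) \<in> hb X"
  by (auto simp: hb_def)

lemma sloc_trans: "(x, y) \<in> sloc X \<Longrightarrow> (y, z) \<in> sloc X \<Longrightarrow> (x, z) \<in> sloc X"
  using wf by (auto simp: wf_execution_def equiv_def dest: transD)

lemma rfD: "(x, y) \<in> rf X \<Longrightarrow> x \<in> writes X \<and> y \<in> reads X \<and> (x, y) \<in> sloc X"
  using wf by (auto simp: wf_execution_def)

lemma coD: "(x, y) \<in> co X \<Longrightarrow> x \<in> writes X \<and> y \<in> writes X \<and> (x, y) \<in> sloc X"
  using wf by (auto simp: wf_execution_def)

lemma frD: "(x, y) \<in> fr X \<Longrightarrow> x \<in> reads X \<and> y \<in> writes X \<and> (x, y) \<in> sloc X"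
  by (auto simp: fr_def)

lemma reads_writes: "x \<in> reads X \<Longrightarrow> x \<in> writes X \<Longrightarrow> False"
  using wf by (auto simp: wf_execution_def)

lemma sloc_not_fence: "(x, y) \<in> sloc X \<Longrightarrow> x \<in> reads X \<or> x \<in> writes X"
  using wf by (auto simp: wf_execution_def equiv_def refl_on_def)

lemma co_irrefl: "(x, x) \<notin> co X"
proof
  assume x: "(x, x) \<in> co X"
  let ?C = "sloc X `` {x} \<inter> writes X"
  from x have "x \<in> ?C" using coD by auto
  moreover have "sloc X `` {x} \<in> (reads X \<union> writes X) // sloc X"
    using coD[OF x] by (auto intro: quotientI)
  then have "irrefl (co X \<inter> (?C \<times> ?C))"
    using wf by (auto simp: wf_execution_def strict_linear_order_on_def)
  ultimately show False using x by (auto simp: irrefl_def)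
qed

lemma com_cases:
  assumes "(x, y) \<in> com X"
  obtains (rf) "(x, y) \<in> rf X" "x \<in> writes X" "y \<in> reads X" "(x, y) \<in> sloc X"
  | (co) "(x, y) \<in> co X" "x \<in> writes X" "y \<in> writes X" "(x, y) \<in> sloc X"
  | (fr) "(x, y) \<in> fr X" "x \<in> reads X" "y \<in> writes X" "(x, y) \<in> sloc X"
  using assms rfD coD frD unfolding com_def by auto

lemma com_cnf:
  assumes "(x, y) \<in> com X"
  shows "(x, y) \<in> cnf X"
  using assms
proof (cases rule: com_cases)
  case co
  then show ?thesis using co_irrefl by (auto simp: cnf_def)
qed (use reads_writes in \<open>auto simp: cnf_def\<close>)

text \<open>Both \<open>rf\<close> and \<open>co\<close> start at writes, and so does
  \<open>co X O rf X\<close>; only \<open>fr\<close> can leave a read.\<close>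

lemma ecom_read:
  assumes "(x, y) \<in> ecom X" "x \<in> reads X"
  shows "y \<in> writes X" "(x, y) \<in> sloc X"
proof -
  have "(x, y) \<in> com X"
    using assms coD reads_writes by (auto simp: ecom_def)
  then have "y \<in> writes X \<and> (x, y) \<in> sloc X"
    by (cases rule: com_cases) (use assms(2) reads_writes in auto)
  then show "y \<in> writes X" "(x, y) \<in> sloc X" by auto
qed

lemma ecom_access: "(x, y) \<in> ecom X \<Longrightarrow> x \<in> reads X \<or> x \<in> writes X"
  by (auto simp: ecom_def dest: coD elim: com_cases)

text \<open>These edges stand in for \<open>sw\<close> in inductions over \<open>hb\<close>:
  \<open>sw\<close> decomposes into them and \<open>po\<close>, and once all atomics are SC each of
  them is itself an \<open>sw\<close> edge.\<close>

definition rf_at :: "'e rel" where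
  "rf_at = rf X \<inter> (Ato X \<times> Ato X)"

lemma rmwD:
  assumes "(x, y) \<in> rmw X"
  shows "(x, y) \<in> po X \<and> x \<in> Ato X \<and> y \<in> Ato X"
proof -
  have "rmw X \<subseteq> (reads X \<times> writes X) \<inter> loc X (po X)"
    using wf by (simp add: wf_execution_def)
  moreover have "rmw X \<subseteq> Ato X \<times> Ato X"
    using wf_cpp by (simp add: wf_cpp_execution_def)
  ultimately show ?thesis using assms by (auto simp: loc_def)
qed

text \<open>Every \<open>rmw\<close> edge is a \<open>po\<close> edge with atomic ends, so the read
  between \<open>rf\<close> and \<open>rmw\<close> is atomic, and atomicity passes on to the next
  write of the chain.\<close>

lemma release_sequence:
  assumes "(w, v) \<in> (rf X O rmw X)\<^sup>*" "w \<in> Ato X"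
  shows "(w, v) \<in> (po X \<union> rf_at)\<^sup>* \<and> v \<in> Ato X"
  using assms(1)
proof (induction rule: rtrancl_induct)
  case base
  then show ?case using assms(2) by simp
next
  case (step y z)
  then obtain r where r: "(y, r) \<in> rf X" "(r, z) \<in> rmw X" by auto
  from rmwD[OF r(2)] r(1) step.IH
  have *: "(y, r) \<in> po X \<union> rf_at" "(r, z) \<in> po X \<union> rf_at" "z \<in> Ato X"
    by (simp_all add: rf_at_def)
  from step.IH have "(w, y) \<in> (po X \<union> rf_at)\<^sup>*" by simp
  then have "(w, r) \<in> (po X \<union> rf_at)\<^sup>*" using *(1) by (rule rtrancl_into_rtrancl)
  then have "(w, z) \<in> (po X \<union> rf_at)\<^sup>*" using *(2) by (rule rtrancl_into_rtrancl)
  with *(3) show ?case by simp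
qed

lemma sw_subset: "sw X \<subseteq> (po X \<union> rf_at)\<^sup>+"
proof (rule subrelI)
  fix x y assume "(x, y) \<in> sw X"
  then obtain u w v s r where
    s: "(x, u) \<in> (Id_on (fences X) O po X)\<^sup>=" "(u, w) \<in> (loc X (po X))\<^sup>*" "w \<in> Ato X"
      "(w, v) \<in> (rf X O rmw X)\<^sup>*" "(v, s) \<in> rf X" "s \<in> Ato X"
      "(s, y) \<in> (po X O Id_on (fences X))\<^sup>="
    unfolding sw_def by (elim relcompE Id_onE) (simp only: prod.inject, blast)
  let ?R = "po X \<union> rf_at"
  have "(x, u) \<in> ?R\<^sup>*" "(s, y) \<in> ?R\<^sup>*" using s(1,7) by auto
  moreover have "loc X (po X) \<subseteq> ?R" by (auto simp: loc_def)
  then have "(u, w) \<in> ?R\<^sup>*" using s(2) rtrancl_mono by blast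
  moreover have "(w, v) \<in> ?R\<^sup>*" "(v, s) \<in> ?R"
    using release_sequence[OF s(4,3)] s(5,6) by (auto simp: rf_at_def)
  ultimately show "(x, y) \<in> ?R\<^sup>+"
    by (meson rtrancl_trans rtrancl_into_trancl1 trancl_rtrancl_trancl)
qed

lemma hb_subset: "hb X \<subseteq> (po X \<union> rf_at \<union> tsw X)\<^sup>+"
proof -
  let ?R = "po X \<union> rf_at \<union> tsw X"
  have "sw X \<subseteq> ?R\<^sup>+"
    using sw_subset trancl_mono_subset[of "po X \<union> rf_at" ?R] by blast
  then have "sw X \<union> tsw X \<union> po X \<subseteq> ?R\<^sup>+" by auto
  then have "(sw X \<union> tsw X \<union> po X)\<^sup>+ \<subseteq> (?R\<^sup>+)\<^sup>+" by (rule trancl_mono_subset)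
  then show ?thesis by (simp add: hb_def)
qed

end


section \<open>Race-free executions whose atomics are all SC\<close>

locale drf_execution = wf_cpp X for X :: "('e, 't, 'z) cpp_execution_scheme" +
  assumes consistent: "cpp_consistent X"
    and stxn_at_no_Ato: "Domain (stxn_at X) \<inter> Ato X = {}"
    and stxn_at: "stxn X = stxn_at X"
    and Ato_SC: "Ato X = SC X"
    and no_race: "NoRace X"
begin

lemma stxn_not_Ato:
  assumes "(x, y) \<in> stxn X"
  shows "x \<notin> SC X" "y \<notin> SC X"
  using assms stxn_sym[OF assms] stxn_at_no_Ato stxn_at Ato_SC by auto

lemma tsw_not_SC:
  assumes "(x, y) \<in> tsw X"
  shows "x \<notin> SC X" "y \<notin> SC X"
  using assms stxn_not_Ato unfolding tsw_def weaklift_def by blast+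

lemma hb_com_irrefl: "(x, y) \<in> hb X \<Longrightarrow> (y, x) \<in> (com X)\<^sup>* \<Longrightarrow> False"
  using consistent by (auto simp: cpp_consistent_def HbCom_def irrefl_def)

lemma cnf_hb:
  assumes "(x, y) \<in> cnf X" "x \<notin> SC X \<or> y \<notin> SC X"
  shows "(x, y) \<in> hb X \<or> (y, x) \<in> hb X"
  using assms no_race Ato_SC by (auto simp: NoRace_def)

text \<open>An SC write is a release and an SC read an acquire, so \<open>sw\<close> holds with all
  its optional and iterated parts empty.\<close>

lemma rf_at_sw:
  assumes "(x, y) \<in> rf_at"
  shows "(x, y) \<in> sw X"
proof -
  have *: "(x, y) \<in> rf X" "x \<in> SC X" "y \<in> SC X" using assms Ato_SC by (auto simp: rf_at_def)
  with rfD have wr: "x \<in> writes X" "y \<in> reads X" by auto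
  with * wf_cpp have "x \<in> Rel X" "y \<in> Acq X" by (auto simp: wf_cpp_execution_def)
  with * wr Ato_SC show ?thesis
    unfolding sw_def by (intro relcompI[of _ x] relcompI[of _ y] Id_onI) auto
qed

lemma rf_at_hb: "(x, y) \<in> rf_at \<Longrightarrow> (x, y) \<in> hb X"
  using rf_at_sw by (auto simp: hb_def)

lemma hb_step_hb: "(x, y) \<in> po X \<union> rf_at \<union> tsw X \<Longrightarrow> (x, y) \<in> hb X"
  using rf_at_hb po_hb tsw_hb by blast

text \<open>Reduces inductions over \<open>hb\<close> to three kinds of step: \<open>po\<close>, an
  \<open>rf\<close> edge between SC events, and \<open>tsw\<close>, whose ends are never SC.\<close>

lemma hb_steps: "hb X = (po X \<union> rf_at \<union> tsw X)\<^sup>+"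
proof
  have "po X \<union> rf_at \<union> tsw X \<subseteq> hb X" using hb_step_hb by auto
  then have "(po X \<union> rf_at \<union> tsw X)\<^sup>+ \<subseteq> (hb X)\<^sup>+" by (rule trancl_mono_subset)
  then show "(po X \<union> rf_at \<union> tsw X)\<^sup>+ \<subseteq> hb X" by (simp add: hb_def)
qed (rule hb_subset)

lemma rf_at_SC: "(x, y) \<in> rf_at \<Longrightarrow> x \<in> SC X \<and> y \<in> SC X \<and> (x, y) \<in> sloc X"
  using Ato_SC rfD by (auto simp: rf_at_def)

text \<open>Final steps inside the transaction of \<open>y\<close> are dropped. The step that enters
  it is \<open>po\<close>, lifted by contiguity, or \<open>tsw\<close>, which absorbs
  \<open>stxn\<close>; it is not in \<open>rf_at\<close>, whose ends are atomic. The dual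
  \<open>stxn_hb\<close> peels steps off the front.\<close>

lemma hb_stxn:
  assumes "(x, y) \<in> hb X" "(x, y) \<notin> stxn X" "(y, z) \<in> stxn X"
  shows "(x, z) \<in> hb X"
proof -
  have single: "(w, z) \<in> hb X"
    if "(w, y) \<in> po X \<union> rf_at \<union> tsw X" "(w, y) \<notin> stxn X" "(y, z) \<in> stxn X" for w y z
    using that po_stxn tsw_stxn rf_at_SC stxn_not_Ato by (blast intro: po_hb tsw_hb)
  from assms show ?thesis unfolding hb_steps
  proof (induction arbitrary: z rule: trancl_induct)
    case (base y)
    then show ?case using single hb_steps by blast
  next
    case (step y w)
    show ?case
    proof (cases "(y, w) \<in> stxn X")
      case True
      with step.prems have "(x, y) \<notin> stxn X" "(y, z) \<in> stxn X" by (auto intro: stxn_trans)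
      then show ?thesis by (rule step.IH)
    next
      case False
      with single step show ?thesis using hb_steps by (metis trancl_trans)
    qed
  qed
qed

lemma stxn_hb:
  assumes "(y, z) \<in> hb X" "(y, z) \<notin> stxn X" "(x, y) \<in> stxn X"
  shows "(x, z) \<in> hb X"
proof -
  have single: "(x, w) \<in> hb X"
    if "(y, w) \<in> po X \<union> rf_at \<union> tsw X" "(y, w) \<notin> stxn X" "(x, y) \<in> stxn X" for w y x
    using that stxn_po stxn_tsw rf_at_SC stxn_not_Ato by (blast intro: po_hb tsw_hb)
  from assms show ?thesis unfolding hb_steps
  proof (induction arbitrary: x rule: converse_trancl_induct)
    case (base y)
    then show ?case using single hb_steps by blast
  next
    case (step y w)
    show ?case
    proof (cases "(y, w) \<in> stxn X")
      case True
      with step.prems have "(w, z) \<notin> stxn X" "(x, w) \<in> stxn X" by (auto intro: stxn_trans)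
      then show ?thesis by (rule step.IH)
    next
      case False
      with single step show ?thesis using hb_steps by (metis trancl_trans)
    qed
  qed
qed

text \<open>The relation \<open>N\<close> of the overview. It omits \<open>rf\<close>, which between
  SC events already lies in \<open>hb\<close>.\<close>

definition com_sc :: "'e rel" where
  "com_sc = (co X \<union> fr X) \<inter> (SC X \<times> SC X)"

lemma com_scD:
  assumes "(x, y) \<in> com_sc"
  shows "(x, y) \<in> com X" "x \<in> SC X" "y \<in> SC X" "(x, y) \<in> sloc X" "y \<in> writes X"
  using assms coD frD by (auto simp: com_sc_def com_def)

text \<open>If an end is not SC, race freedom orders the conflicting pair by \<open>hb\<close>, and
  HbCom rules out the direction against \<open>com\<close>.\<close>

lemma com_subset: "com X \<subseteq> hb X \<union> com_sc"
proof (rule subrelI)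
  fix x y assume xy: "(x, y) \<in> com X"
  show "(x, y) \<in> hb X \<union> com_sc"
  proof (cases "x \<in> SC X \<and> y \<in> SC X")
    case True
    with xy Ato_SC rf_at_hb show ?thesis by (auto simp: com_def com_sc_def rf_at_def)
  next
    case False
    moreover have "(y, x) \<notin> hb X" using xy hb_com_irrefl by blast
    ultimately show ?thesis using cnf_hb[OF com_cnf[OF xy]] by auto
  qed
qed

text \<open>An \<open>hb\<close> edge is lifted first at its source, then at its target. The ends of
  a \<open>com_sc\<close> edge lie in no transaction, so there the lifting is trivial.\<close>

lemma stronglift_subset: "stronglift (po X \<union> com X) (stxn X) \<subseteq> hb X \<union> com_sc"
proof (rule subrelI)
  fix x y assume "(x, y) \<in> stronglift (po X \<union> com X) (stxn X)"
  then obtain u v where u: "x = u \<or> (x, u) \<in> stxn X" and v: "v = y \<or> (v, y) \<in> stxn X"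
    and uv: "(u, v) \<in> po X \<union> com X" "(u, v) \<notin> stxn X"
    by (auto simp: stronglift_def)
  then consider "(u, v) \<in> hb X" | "(u, v) \<in> com_sc" using com_subset po_hb by blast
  then show "(x, y) \<in> hb X \<union> com_sc"
  proof cases
    case 1
    with u uv(2) have "(x, v) \<in> hb X" using stxn_hb by blast
    moreover have "(x, v) \<notin> stxn X" using u uv(2) by (meson stxn_sym stxn_trans)
    ultimately show ?thesis using v hb_stxn by blast
  next
    case 2
    with u v have "x = u" "v = y" using com_scD stxn_not_Ato by blast+
    with 2 show ?thesis by simp
  qed
qed

section \<open>Segments of \<open>hb\<close> between SC events, and their cover by
  \<open>psc\<close>\<close>

lemma scb_psc: "(x, y) \<in> scb X \<Longrightarrow> x \<in> SC X \<Longrightarrow> y \<in> SC X \<Longrightarrow> (x, y) \<in> psc X"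
  unfolding psc_def by blast

lemma hb_loc_psc: "(x, y) \<in> loc X (hb X) \<Longrightarrow> x \<in> SC X \<Longrightarrow> y \<in> SC X \<Longrightarrow> (x, y) \<in> psc X"
  by (rule scb_psc) (auto simp: scb_def)

lemma po_psc: "(x, y) \<in> po X \<Longrightarrow> x \<in> SC X \<Longrightarrow> y \<in> SC X \<Longrightarrow> (x, y) \<in> psc X"
  by (rule scb_psc) (auto simp: scb_def)

lemma loc_hb_trans:
  "(x, y) \<in> loc X (hb X) \<Longrightarrow> (y, z) \<in> loc X (hb X) \<Longrightarrow> (x, z) \<in> loc X (hb X)"
  by (auto simp: loc_def intro: hb_trans sloc_trans)

text \<open>Follows the path from \<open>a\<close> until it leaves the location of \<open>a\<close>.
  The case \<open>leave\<close> supplies the first \<open>nloc X (po X)\<close> factor of the middle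
  part of \<open>scb\<close>; the case \<open>plain_write\<close> supplies a write that conflicts
  with the source of a \<open>com_sc\<close> edge into \<open>a\<close>.\<close>

lemma hb_leave_location:
  assumes "(a, b) \<in> hb X" "a \<in> SC X" "b \<in> SC X"
  obtains (same) "(a, b) \<in> loc X (hb X)"
  | (plain_write) x where "x \<in> writes X - SC X" "(a, x) \<in> loc X (hb X)" "(x, b) \<in> hb X"
  | (leave) s x where "s \<in> SC X" "(a, s) \<in> (loc X (hb X))\<^sup>=" "(s, x) \<in> nloc X (po X)"
      "(x, b) \<in> (hb X)\<^sup>="
proof -
  define P where "P a \<longleftrightarrow> (a, b) \<in> loc X (hb X) \<or>
    (\<exists>x \<in> writes X - SC X. (a, x) \<in> loc X (hb X) \<and> (x, b) \<in> hb X) \<or>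
    (\<exists>s \<in> SC X. \<exists>x. (a, s) \<in> (loc X (hb X))\<^sup>= \<and> (s, x) \<in> nloc X (po X) \<and> (x, b) \<in> (hb X)\<^sup>=)"
    for a
  have P_hb_loc: "P a" if "(a, u) \<in> (loc X (hb X))\<^sup>=" "P u" for a u
    using that loc_hb_trans unfolding P_def by blast
  have P_po: "P a" if "(a, v) \<in> po X" "(v, b) \<in> (hb X)\<^sup>=" "a \<in> SC X" "(a, v) \<notin> sloc X" for a v
    using that unfolding P_def nloc_def by blast
  have loc_po: "(a, v) \<in> loc X (hb X)" if "(a, v) \<in> loc X (po X)" for a v
    using that po_hb by (auto simp: loc_def)
  text \<open>A non-atomic read of the location of \<open>a\<close> need not conflict with the \<open>com\<close> predecessor of
    \<open>a\<close>, so the induction has to run through such reads until a write or another location.\<close>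
  have "\<forall>a \<in> SC X. (a, u) \<in> (loc X (po X))\<^sup>= \<longrightarrow> P a"
    if "(u, b) \<in> (po X \<union> rf_at \<union> tsw X)\<^sup>+" for u
    using that
  proof (induction rule: converse_trancl_induct)
    case (base u)
    show ?case
    proof (intro ballI impI)
      fix a assume a: "a \<in> SC X" "(a, u) \<in> (loc X (po X))\<^sup>="
      have "(u, b) \<notin> tsw X" using tsw_not_SC assms(3) by blast
      with base consider "(u, b) \<in> po X" | "(u, b) \<in> rf_at" by blast
      then show "P a"
      proof cases
        case 1
        with a(2) have ab: "(a, b) \<in> po X" by (auto simp: loc_def intro: po_trans)
        show ?thesis
        proof (cases "(a, b) \<in> sloc X")
          case True
          with ab po_hb show ?thesis by (auto simp: P_def loc_def)
        next
          case False
          with ab a P_po show ?thesis by blast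
        qed
      next
        case 2
        then have "P u" using rf_at_SC rf_at_hb by (auto simp: P_def loc_def)
        with a(2) loc_po P_hb_loc show ?thesis by blast
      qed
    qed
  next
    case (step u v)
    show ?case
    proof (intro ballI impI)
      fix a assume a: "a \<in> SC X" "(a, u) \<in> (loc X (po X))\<^sup>="
      have vb: "(v, b) \<in> hb X" using step.hyps(2) hb_steps by simp
      from step.hyps(1) consider "(u, v) \<in> po X" | "(u, v) \<in> rf_at" | "(u, v) \<in> tsw X" by blast
      then show "P a"
      proof cases
        case 1
        with a(2) have av: "(a, v) \<in> po X" by (auto simp: loc_def intro: po_trans)
        show ?thesis
        proof (cases "(a, v) \<in> sloc X")
          case True
          with av a step.IH show ?thesis by (auto simp: loc_def)
        next
          case False
          with av a P_po vb show ?thesis by blast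
        qed
      next
        case 2
        \<comment> \<open>The target \<open>v\<close> is SC, so the induction hypothesis applies
          with \<open>v\<close> itself as the start.\<close>
        with step.IH have "P v" using rf_at_SC by blast
        moreover have "(u, v) \<in> loc X (hb X)" using 2 rf_at_SC rf_at_hb by (auto simp: loc_def)
        ultimately have "P u" using P_hb_loc by blast
        with a(2) loc_po P_hb_loc show ?thesis by blast
      next
        case 3
        then have "u \<notin> SC X" using tsw_not_SC by blast
        with a have au: "(a, u) \<in> po X" by (auto simp: loc_def)
        from 3 obtain y z where y: "(u, y) \<in> stxn X" "(y, z) \<in> ecom X" "(y, z) \<notin> stxn X"
          "(z, v) \<in> stxn X"
          by (auto simp: tsw_def weaklift_def)
        \<comment> \<open>Being SC, \<open>a\<close> lies outside the transaction of
          \<open>u\<close>, so it precedes all of that transaction.\<close>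
        have ay: "(a, y) \<in> po X" using po_stxn[OF au y(1)] a(1) stxn_not_Ato by blast
        have yv: "(y, v) \<in> hb X" using stxn_tsw[OF stxn_sym[OF y(1)] 3] by (rule tsw_hb)
        have yz: "(y, z) \<in> hb X"
          using tsw_stxn[OF stxn_tsw[OF stxn_sym[OF y(1)] 3] stxn_sym[OF y(4)]] by (rule tsw_hb)
        have zb: "(z, b) \<in> hb X"
          using stxn_hb[OF vb _ y(4)] stxn_not_Ato assms(3) by blast
        have yb: "(y, b) \<in> hb X" using yv vb by (rule hb_trans)
        show ?thesis
        \<comment> \<open>At another location, \<open>y\<close> is where the path leaves. At the
          same location, either \<open>y\<close> is the plain write, or it is a read and its
          \<open>ecom\<close> successor \<open>z\<close> is.\<close>
        proof (cases "(a, y) \<in> sloc X")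
          case False
          with ay yb a(1) P_po show ?thesis by blast
        next
          case True
          from ecom_access[OF y(2)] consider "y \<in> writes X" | "y \<in> reads X" by blast
          then show ?thesis
          proof cases
            case 1
            moreover have "y \<notin> SC X" using y(1) stxn_not_Ato by blast
            moreover have "(a, y) \<in> loc X (hb X)" using True ay po_hb by (auto simp: loc_def)
            ultimately show ?thesis using yb unfolding P_def by blast
          next
            case 2
            note z = ecom_read[OF y(2) 2]
            have "(a, z) \<in> loc X (hb X)"
              using True z(2) ay yz by (auto simp: loc_def intro: sloc_trans hb_trans po_hb)
            moreover have "z \<notin> SC X" using y(4) stxn_not_Ato by blast
            ultimately show ?thesis using z(1) zb unfolding P_def by blast
          qed
        qed
      qed
    qed
  qed
  then have "P a" using assms(1,2) unfolding hb_steps by blast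
  then show thesis unfolding P_def using same plain_write leave by blast
qed

text \<open>Looser than \<open>hb_leave_location\<close>: the case \<open>access\<close> allows
  reads, because a \<open>com_sc\<close> edge out of \<open>b\<close> ends in a write and so
  conflicts with any access to that location. Hence non-SC events end the search at once.\<close>

lemma hb_enter_location:
  assumes "(a, b) \<in> hb X" "b \<in> SC X"
  obtains (same) "(a, b) \<in> loc X (hb X)"
  | (access) y where "y \<notin> SC X" "(a, y) \<in> hb X" "(y, b) \<in> loc X (hb X)"
  | (enter) s y where "s \<in> SC X" "(s, b) \<in> (loc X (hb X))\<^sup>=" "(y, s) \<in> nloc X (po X)"
      "(a, y) \<in> (hb X)\<^sup>="
proof -
  define P where "P b \<longleftrightarrow> (a, b) \<in> loc X (hb X) \<or>
    (\<exists>y. y \<notin> SC X \<and> (a, y) \<in> hb X \<and> (y, b) \<in> loc X (hb X)) \<or>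
    (\<exists>s \<in> SC X. \<exists>y. (s, b) \<in> (loc X (hb X))\<^sup>= \<and> (y, s) \<in> nloc X (po X) \<and> (a, y) \<in> (hb X)\<^sup>=)"
    for b
  have P_hb_loc: "P b" if "(u, b) \<in> loc X (hb X)" "P u" for b u
    using that loc_hb_trans unfolding P_def by blast
  have last: "(u, b) \<in> nloc X (po X) \<or> (u, b) \<in> loc X (hb X)"
    if "(u, b) \<in> po X \<union> rf_at \<union> tsw X" "b \<in> SC X" for u b
  proof -
    from that tsw_not_SC(2) consider "(u, b) \<in> po X" | "(u, b) \<in> rf_at" by blast
    then show ?thesis
      by cases (auto simp: loc_def nloc_def po_hb rf_at_hb dest: rf_at_SC)
  qed
  have "b \<in> SC X \<longrightarrow> P b" if "(a, b) \<in> (po X \<union> rf_at \<union> tsw X)\<^sup>+"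
    using that
  proof (induction rule: trancl_induct)
    case (base b)
    then show ?case using last unfolding P_def by blast
  next
    case (step u b)
    have au: "(a, u) \<in> hb X" using step.hyps(1) hb_steps by simp
    show ?case
    proof
      assume b: "b \<in> SC X"
      with step.hyps(2) consider "(u, b) \<in> nloc X (po X)" | "(u, b) \<in> loc X (hb X)"
        using last by blast
      then show "P b"
      proof cases
        case 1
        with au b show ?thesis unfolding P_def by blast
      next
        case 2
        with au step.IH P_hb_loc show ?thesis unfolding P_def by blast
      qed
    qed
  qed
  then have "P b" using assms unfolding hb_steps by blast
  then show thesis unfolding P_def using same access enter by blast
qed

text \<open>As \<open>x\<close> is a write, it conflicts with \<open>d\<close>. The order
  \<open>x\<close> before \<open>d\<close> would give \<open>hb\<close> from \<open>a\<close> to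
  \<open>d\<close> against the \<open>com\<close> edge from \<open>d\<close> to
  \<open>a\<close>.\<close>

lemma hb_from_com_sc:
  assumes "(d, a) \<in> com_sc" "(a, x) \<in> loc X (hb X)" "x \<in> writes X - SC X"
  shows "(d, x) \<in> hb X"
proof -
  note d = com_scD[OF assms(1)]
  have dx: "(d, x) \<in> sloc X" "d \<noteq> x"
    using assms d(2,4) by (auto simp: loc_def intro: sloc_trans)
  then have "(d, x) \<in> cnf X"
    using sloc_not_fence assms(3) by (auto simp: cnf_def)
  then consider "(d, x) \<in> hb X" | "(x, d) \<in> hb X" using cnf_hb assms(3) by blast
  then show ?thesis
  proof cases
    case 2
    then have "(a, d) \<in> hb X" using assms(2) by (auto simp: loc_def intro: hb_trans)
    with d(1) hb_com_irrefl show ?thesis by blast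
  qed
qed

text \<open>Here the conflict comes from \<open>e\<close>, the target of \<open>com_sc\<close>,
  being a write.\<close>

lemma hb_to_com_sc:
  assumes "(b, e) \<in> com_sc" "(y, b) \<in> loc X (hb X)" "y \<notin> SC X"
  shows "(y, e) \<in> hb X"
proof -
  note e = com_scD[OF assms(1)]
  have ye: "(y, e) \<in> sloc X" "y \<noteq> e"
    using assms e(3,4) by (auto simp: loc_def intro: sloc_trans)
  then have "(y, e) \<in> cnf X"
    using sloc_not_fence e(5) by (auto simp: cnf_def)
  then consider "(y, e) \<in> hb X" | "(e, y) \<in> hb X" using cnf_hb assms(3) by blast
  then show ?thesis
  proof cases
    case 2
    then have "(e, b) \<in> hb X" using assms(2) by (auto simp: loc_def intro: hb_trans)
    with e(1) hb_com_irrefl show ?thesis by blast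
  qed
qed

text \<open>Splitting the segment at both ends gives SC events \<open>s\<close> and
  \<open>s'\<close>, reached from \<open>a\<close> and leading to \<open>b\<close> within one
  location, and joined by a single \<open>scb\<close> edge. Every other outcome is a non-SC access
  that yields a shortcut or a short \<open>psc\<close> path.\<close>

lemma hb_between_com_sc:
  assumes da: "(d, a) \<in> com_sc" and ab: "(a, b) \<in> hb X" and be: "(b, e) \<in> com_sc"
  shows "(a, b) \<in> (psc X)\<^sup>+ \<or> (d, b) \<in> hb X \<or> (a, e) \<in> hb X"
proof -
  have a: "a \<in> SC X" and b: "b \<in> SC X" using da be com_scD by auto
  have bypass: ?thesis if "y \<notin> SC X" "(a, y) \<in> hb X" "(y, b) \<in> loc X (hb X)" for y
    using hb_to_com_sc[OF be that(3,1)] that(2) hb_trans by blast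
  have loc_psc: "(x, y) \<in> (psc X)\<^sup>*" if "(x, y) \<in> (loc X (hb X))\<^sup>=" "x \<in> SC X" "y \<in> SC X" for x y
    using that hb_loc_psc by blast
  from ab a b show ?thesis
  proof (cases rule: hb_leave_location)
    case same
    then show ?thesis using hb_loc_psc a b by blast
  next
    case (plain_write x)
    then show ?thesis using hb_from_com_sc[OF da] hb_trans by blast
  next
    case (leave s x)
    have s: "(a, s) \<in> (psc X)\<^sup>*" using leave loc_psc a by blast
    have sx: "(s, x) \<in> po X" using leave by (auto simp: nloc_def)
    have ax: "(a, x) \<in> hb X" using leave(2) sx po_hb hb_trans by (auto simp: loc_def)
    show ?thesis
    proof (cases "x = b")
      case True
      then have "(s, b) \<in> psc X" using sx leave(1) b po_psc by blast
      with s show ?thesis by (auto dest: rtrancl_into_trancl1)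
    next
      case False
      with leave(4) have xb: "(x, b) \<in> hb X" by auto
      then show ?thesis using b
      proof (cases rule: hb_enter_location)
        case same
        show ?thesis
        \<comment> \<open>The rest of the path keeps to the location of \<open>b\<close>, so
          \<open>x\<close> is an access to it: an SC one splits the path into two \<open>psc\<close>
          edges, any other gives a shortcut.\<close>
        proof (cases "x \<in> SC X")
          case True
          with same sx leave(1) b have "(s, x) \<in> psc X" "(x, b) \<in> psc X"
            using po_psc hb_loc_psc by auto
          with s show ?thesis by (meson rtrancl_into_trancl1 trancl.trancl_into_trancl)
        next
          case False
          with bypass ax same show ?thesis by blast
        qed
      next
        case (access y)
        then show ?thesis using bypass ax hb_trans by blast
      next
        case (enter s' y)
        have s': "(s', b) \<in> (psc X)\<^sup>*" using enter loc_psc b by blast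
        have "(s, s') \<in> psc X"
        \<comment> \<open>With no \<open>hb\<close> step between \<open>x\<close> and
          \<open>y\<close>, the two \<open>po\<close> edges compose to one, which \<open>scb\<close>
          contains directly.\<close>
        proof (cases "x = y")
          case True
          with sx enter(3) have "(s, s') \<in> po X" by (auto simp: nloc_def intro: po_trans)
          with leave(1) enter(1) po_psc show ?thesis by blast
        next
          case False
          with enter leave(3) have "(s, s') \<in> nloc X (po X) O hb X O nloc X (po X)" by blast
          then have "(s, s') \<in> scb X" by (auto simp: scb_def)
          with leave(1) enter(1) scb_psc show ?thesis by blast
        qed
        with s s' show ?thesis by (meson rtrancl_into_trancl1 trancl_rtrancl_trancl)
      qed
    qed
  qed
qed

lemma acyclic_hb_com_sc: "acyclic (hb X \<union> com_sc)"
proof (rule acyclic_Un_bypass)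
  show "trans (hb X)" using hb_trans by (rule transI)
  show "irrefl (hb X)" using hb_com_irrefl by (auto simp: irrefl_def)
  show "com_sc \<subseteq> psc X"
    using scb_psc by (auto simp: com_sc_def scb_def)
  show "acyclic (psc X)" using consistent by (simp add: cpp_consistent_def SeqCst_def)
qed (rule hb_between_com_sc)

end

section \<open>Transactional sequential consistency\<close>

theorem theorem7p3:
  fixes X :: "('e, 't) cpp_execution"
  assumes "wf_cpp_execution X"
    and "cpp_consistent X"
    and "Domain (stxn_at X) \<inter> Ato X = {}"
    and "stxn X = stxn_at X"
    and "Ato X = SC X"
    and "NoRace X"
  shows "tsc_consistent X"
proof -
  interpret drf_execution X
    using assms by unfold_locales
  have "po X \<union> com X \<subseteq> hb X \<union> com_sc"
    using com_subset po_hb by auto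
  then show ?thesis unfolding tsc_consistent_def
    using acyclic_subset[OF acyclic_hb_com_sc] stronglift_subset by blast
qed

end
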